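(* Let $G=B(n_1,n_2,m_1P_{k_1},m_2P_{k_2},\dots,m_tP_{k_t})$ be a strong double broom with $k_i>2$ for all $1\le i\le t$. Then $dern(G)=1$ or $dern(G)=2$.
   Context: All graphs are finite, simple and undirected. For an edge $e$ of a graph $G$, $d(e)$ is the number of edges of $G$ adjacent to $e$. A da-ecard of $G$ is the pair $(d(e),G-e)$ with $G-e$ unlabeled; the da-edeck is the multiset of all da-ecards. $dern(G)$ is the size of the smallest sub-multiset of the da-edeck of $G$ not contained in the da-edeck of any graph $H\not\cong G$. A strong double broom is a graph on at least 5 vertices obtained from a union of at least two internally vertex disjoint paths with common ends $u,v$ (hub vertices) by appending leaves at $u$ and $v$. $B(n_1,n_2,m_1P_{k_1},\dots,m_tP_{k_t})$ (with $k_1<\dots<k_t$, $m_i\ge0$) denotes the strong double broom with $n_1$ leaves at $u$, $n_2$ leaves at $v$, and for each $i$ exactly $m_i$ internally vertex disjoint $(u,v)$-paths on $k_i$ vertices. *)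

theory Defs
  imports "HOL-Library.Multiset" "HOL-Library.Extended_Nat"
begin

section \<open>Finite simple undirected graphs\<close>

datatype 'a graph = Graph (verts: "'a set") (edges: "'a set set")

definition simple_graph :: "'a graph \<Rightarrow> bool" where
  "simple_graph G \<longleftrightarrow> finite (verts G) \<and> (\<forall>e\<in>edges G. e \<subseteq> verts G \<and> card e = 2)"

definition isomorphic :: "'a graph \<Rightarrow> 'b graph \<Rightarrow> bool" where
  "isomorphic G H \<longleftrightarrow> (\<exists>f. bij_betw f (verts G) (verts H) \<and>
     (\<forall>x\<in>verts G. \<forall>y\<in>verts G. {x, y} \<in> edges G \<longleftrightarrow> {f x, f y} \<in> edges H))"

definition edge_degree :: "'a graph \<Rightarrow> 'a set \<Rightarrow> nat" where
  "edge_degree G e = card {e' \<in> edges G. e' \<noteq> e \<and> e' \<inter> e \<noteq> {}}"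

definition delete_edge :: "'a graph \<Rightarrow> 'a set \<Rightarrow> 'a graph" where
  "delete_edge G e = Graph (verts G) (edges G - {e})"

section \<open>Degree associated edge-cards and dern\<close>

text \<open>An unlabeled finite graph is an isomorphism class.  Every finite graph has a copy on
  natural numbers, so the class is represented by its members with vertices of type nat; this
  makes the cards of graphs over different vertex types comparable.\<close>

definition unlabeled :: "'a graph \<Rightarrow> nat graph set" where
  "unlabeled G = {H. simple_graph H \<and> isomorphic G H}"

definition da_ecard :: "'a graph \<Rightarrow> 'a set \<Rightarrow> nat \<times> nat graph set" where
  "da_ecard G e = (edge_degree G e, unlabeled (delete_edge G e))"

definition da_edeck :: "'a graph \<Rightarrow> (nat \<times> nat graph set) multiset" where
  "da_edeck G = image_mset (da_ecard G) (mset_set (edges G))"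

text \<open>The value is \<open>\<infinity>\<close> if no sub-multiset of the deck determines the graph.  Letting the
  competitor \<open>H\<close> range over graphs on natural numbers covers all finite graphs up to
  isomorphism.\<close>

definition dern :: "'a graph \<Rightarrow> enat" where
  "dern G = Inf {enat (size S) | S. S \<subseteq># da_edeck G \<and>
     \<not> (\<exists>H :: nat graph. simple_graph H \<and> \<not> isomorphic H G \<and> S \<subseteq># da_edeck H)}"

section \<open>Strong double brooms\<close>

datatype broom_vertex =
    HubU | HubV | LeafU nat | LeafV nat
  | Inner nat nat nat

text \<open>\<open>path_vertex k i j l\<close> is the \<open>l\<close>-th vertex (\<open>1 \<le> l \<le> k i\<close>) of the \<open>j\<close>-th path among those
  on \<open>k i\<close> vertices; only the end vertices are shared between different paths.\<close>

definition path_vertex :: "(nat \<Rightarrow> nat) \<Rightarrow> nat \<Rightarrow> nat \<Rightarrow> nat \<Rightarrow> broom_vertex" where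
  "path_vertex k i j l = (if l = 1 then HubU else if l = k i then HubV else Inner i j l)"

definition broom_graph ::
    "nat \<Rightarrow> nat \<Rightarrow> nat \<Rightarrow> (nat \<Rightarrow> nat) \<Rightarrow> (nat \<Rightarrow> nat) \<Rightarrow> broom_vertex graph" where
  "broom_graph n1 n2 t m k = Graph
     ({HubU, HubV} \<union> LeafU ` {1..n1} \<union> LeafV ` {1..n2} \<union>
      {path_vertex k i j l | i j l. i \<in> {1..t} \<and> j \<in> {1..m i} \<and> l \<in> {1..k i}})
     ({{HubU, LeafU a} | a. a \<in> {1..n1}} \<union> {{HubV, LeafV b} | b. b \<in> {1..n2}} \<union>
      {{path_vertex k i j l, path_vertex k i j (l + 1)} | i j l.
         i \<in> {1..t} \<and> j \<in> {1..m i} \<and> l \<in> {1..<k i}})"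

text \<open>\<open>G = B(n1, n2, m 1 P_{k 1}, ..., m t P_{k t})\<close>, up to isomorphism.  The broom is double,
  so each hub carries at least one leaf (without leaves at the hubs one would get, for example,
  all cycles and \<open>K_{2,3}\<close>, and \<open>dern\<close> of the latter is 3).  In a simple graph at most one of
  the paths can be the single edge on two vertices.\<close>

definition is_strong_double_broom ::
    "'a graph \<Rightarrow> nat \<Rightarrow> nat \<Rightarrow> nat \<Rightarrow> (nat \<Rightarrow> nat) \<Rightarrow> (nat \<Rightarrow> nat) \<Rightarrow> bool" where
  "is_strong_double_broom G n1 n2 t m k \<longleftrightarrow>
     simple_graph G \<and> card (verts G) \<ge> 5 \<and> n1 \<ge> 1 \<and> n2 \<ge> 1 \<and>
     strict_mono_on {1..t} k \<and>
     (\<forall>i\<in>{1..t}. k i \<ge> 2 \<and> (k i = 2 \<longrightarrow> m i \<le> 1)) \<and>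
     (\<Sum>i=1..t. m i) \<ge> 2 \<and>
     isomorphic G (broom_graph n1 n2 t m k)"

end

(* The card of a pendant edge at a hub v, together with the card of any non-pendant edge, almost
   determines G.  A graph with both cards has no isolated vertex because of the second one, so it
   arises from the first one by attaching the isolated vertex to some vertex y, and y has degree
   deg v - 1.  If deg v >= 4, then y is a hub, and if it is the other hub, the result is the mirror
   image of G.  Otherwise G is a cycle with one leaf at each of the two hubs, y lies on the cycle,
   and it remains to detect the distance of the hubs.  If the cycle is longer than 4, delete as
   second edge one on the longer path that avoids both hubs: the shorter path survives and joins
   the only two vertices of degree 3.  On a 4-cycle, delete as second edge one at a hub: the
   resulting tree does not embed when y is adjacent to the other hub. *)

theory Submission
  imports Defs
begin

section \<open>Isomorphisms and cards\<close>

text \<open>Edges are compared as a whole set of images, which suits counting and deleting edges;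
  for simple graphs this agrees with the pairwise condition in \<open>isomorphic\<close>.\<close>

definition graph_iso :: "('a \<Rightarrow> 'b) \<Rightarrow> 'a graph \<Rightarrow> 'b graph \<Rightarrow> bool" where
  "graph_iso f G H \<longleftrightarrow> bij_betw f (verts G) (verts H) \<and> (`) f ` edges G = edges H"

definition degree :: "'a graph \<Rightarrow> 'a \<Rightarrow> nat" where
  "degree G x = card {e \<in> edges G. x \<in> e}"

lemma simple_graph_edgeE:
  assumes "simple_graph G" "e \<in> edges G"
  obtains x y where "e = {x, y}" "x \<noteq> y" "x \<in> verts G" "y \<in> verts G"
  using assms unfolding simple_graph_def by (metis card_2_iff insert_subset)

lemma simple_graph_finite_edges:
  assumes "simple_graph G" shows "finite (edges G)"
proof (rule finite_subset)
  show "edges G \<subseteq> Pow (verts G)" "finite (Pow (verts G))"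
    using assms by (auto simp: simple_graph_def)
qed

lemma verts_delete_edge [simp]: "verts (delete_edge G e) = verts G"
  and edges_delete_edge [simp]: "edges (delete_edge G e) = edges G - {e}"
  by (simp_all add: delete_edge_def)

lemma simple_graph_delete_edge: "simple_graph G \<Longrightarrow> simple_graph (delete_edge G e)"
  by (simp add: simple_graph_def)

text \<open>Every edge of a simple graph is a pair of vertices, so the pairwise condition governs
  all edges; in the other direction injectivity on the vertices recovers an edge from its
  image.\<close>

lemma isomorphic_iff_graph_iso:
  assumes "simple_graph G" "simple_graph H"
  shows "isomorphic G H \<longleftrightarrow> (\<exists>f. graph_iso f G H)"
proof
  assume "isomorphic G H"
  then obtain f where bij: "bij_betw f (verts G) (verts H)"
    and f: "\<And>x y. x \<in> verts G \<Longrightarrow> y \<in> verts G \<Longrightarrow> {x, y} \<in> edges G \<longleftrightarrow> {f x, f y} \<in> edges H"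
    unfolding isomorphic_def by blast
  have "(`) f ` edges G = edges H"
  proof (intro equalityI subsetI)
    fix d assume "d \<in> (`) f ` edges G"
    then obtain e where "e \<in> edges G" "d = f ` e" by blast
    moreover obtain x y where "e = {x, y}" "x \<in> verts G" "y \<in> verts G"
      using simple_graph_edgeE[OF assms(1)] \<open>e \<in> edges G\<close> by metis
    ultimately show "d \<in> edges H" using f[of x y] by simp
  next
    fix d assume d: "d \<in> edges H"
    then obtain x y where xy: "d = {x, y}" "x \<in> verts H" "y \<in> verts H"
      by (rule simple_graph_edgeE[OF assms(2)])
    then obtain x' y' where "x = f x'" "y = f y'" "x' \<in> verts G" "y' \<in> verts G"
      using bij unfolding bij_betw_def by blast
    with f[of x' y'] d xy show "d \<in> (`) f ` edges G"
      by (intro image_eqI[where x = "{x', y'}"]) auto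
  qed
  with bij show "\<exists>f. graph_iso f G H" unfolding graph_iso_def by blast
next
  assume "\<exists>f. graph_iso f G H"
  then obtain f where bij: "bij_betw f (verts G) (verts H)" and f: "(`) f ` edges G = edges H"
    unfolding graph_iso_def by blast
  have "{x, y} \<in> edges G" if "x \<in> verts G" "y \<in> verts G" "{f x, f y} \<in> edges H" for x y
  proof -
    have "{f x, f y} \<in> (`) f ` edges G" using f that(3) by simp
    then obtain e where e: "e \<in> edges G" "f ` {x, y} = f ` e" by auto
    moreover have "e \<subseteq> verts G" using assms e by (auto simp: simple_graph_def)
    ultimately have "{x, y} = e"
      using bij that(1,2) e(2) inj_on_image_eq_iff[of f "verts G" "{x, y}" e] by (simp add: bij_betw_def)
    with e show ?thesis by simp
  qed
  moreover have "{f x, f y} \<in> edges H" if "{x, y} \<in> edges G" for x y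
    using imageI[OF that, of "(`) f"] f by simp
  ultimately show "isomorphic G H" unfolding isomorphic_def using bij by blast
qed

lemma graph_iso_sym:
  assumes "simple_graph G" "graph_iso f G H"
  shows "graph_iso (inv_into (verts G) f) H G"
proof -
  let ?g = "inv_into (verts G) f"
  have bij: "bij_betw f (verts G) (verts H)" and f: "(`) f ` edges G = edges H"
    using assms unfolding graph_iso_def by auto
  have "?g ` f ` e = e" if "e \<in> edges G" for e
    using assms(1) that bij by (auto simp: simple_graph_def bij_betw_def)
  then have "(`) ?g ` (`) f ` edges G = edges G" by (force simp: image_iff)
  with f bij show ?thesis unfolding graph_iso_def by (metis bij_betw_inv_into)
qed

text \<open>A vertex inverse that also preserves edges reduces both inclusions between the edge sets
  to checks on single edges.\<close>

lemma graph_iso_byWitness: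
  assumes "\<And>x. x \<in> verts G \<Longrightarrow> f x \<in> verts H \<and> g (f x) = x"
    and "\<And>y. y \<in> verts H \<Longrightarrow> g y \<in> verts G \<and> f (g y) = y"
    and "\<And>d. d \<in> edges G \<Longrightarrow> f ` d \<in> edges H"
    and "\<And>d. d \<in> edges H \<Longrightarrow> d \<subseteq> verts H \<and> g ` d \<in> edges G"
  shows "graph_iso f G H"
  unfolding graph_iso_def
proof
  show "bij_betw f (verts G) (verts H)"
    by (rule bij_betw_byWitness[where f' = g]) (use assms in auto)
  have "d = f ` g ` d" if "d \<in> edges H" for d
    using assms(2) assms(4)[OF that] by (force simp: image_iff)
  then have "d \<in> (`) f ` edges G" if "d \<in> edges H" for d
    using that assms(4) by (intro image_eqI[where x = "g ` d"]) auto
  with assms(3) show "(`) f ` edges G = edges H" by blast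
qed

lemma isomorphic_refl: "isomorphic G G"
  unfolding isomorphic_def by (rule exI[where x = id]) auto

lemma isomorphic_sym:
  assumes "simple_graph G" "simple_graph H" "isomorphic G H" shows "isomorphic H G"
  using assms graph_iso_sym[OF assms(1)]
  unfolding isomorphic_iff_graph_iso[OF assms(1,2)] isomorphic_iff_graph_iso[OF assms(2,1)] by blast

lemma isomorphic_trans:
  assumes "isomorphic G H" "isomorphic H K" shows "isomorphic G K"
proof -
  obtain f g where f: "bij_betw f (verts G) (verts H)" and g: "bij_betw g (verts H) (verts K)"
    and fe: "\<forall>x\<in>verts G. \<forall>y\<in>verts G. {x, y} \<in> edges G \<longleftrightarrow> {f x, f y} \<in> edges H"
    and ge: "\<forall>x\<in>verts H. \<forall>y\<in>verts H. {x, y} \<in> edges H \<longleftrightarrow> {g x, g y} \<in> edges K"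
    using assms unfolding isomorphic_def by blast
  show ?thesis unfolding isomorphic_def
    using bij_betw_trans[OF f g] fe ge bij_betwE[OF f] by (intro exI[where x = "g \<circ> f"]) auto
qed

section \<open>Degrees and edge-cards under isomorphism\<close>

lemma graph_iso_degree:
  assumes "simple_graph G" "graph_iso f G H" "x \<in> verts G"
  shows "degree H (f x) = degree G x"
proof -
  have inj: "inj_on f (verts G)" and f: "(`) f ` edges G = edges H"
    using assms unfolding graph_iso_def bij_betw_def by auto
  have sub: "e \<subseteq> verts G" if "e \<in> edges G" for e using that assms by (auto simp: simple_graph_def)
  have "{e \<in> edges H. f x \<in> e} = {e \<in> (`) f ` edges G. f x \<in> e}" by (simp add: f)
  also have "\<dots> = (`) f ` {e \<in> edges G. f x \<in> f ` e}" by blast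
  also have "{e \<in> edges G. f x \<in> f ` e} = {e \<in> edges G. x \<in> e}"
    using sub inj_on_image_mem_iff[OF inj assms(3)] by blast
  finally have "{e \<in> edges H. f x \<in> e} = (`) f ` {e \<in> edges G. x \<in> e}" .
  moreover have "inj_on ((`) f) {e \<in> edges G. x \<in> e}"
    using sub inj by (auto intro!: inj_onI simp: inj_on_image_eq_iff)
  ultimately show ?thesis by (simp add: degree_def card_image)
qed

lemma graph_iso_delete_edge:
  assumes "simple_graph G" "graph_iso f G H" "e \<in> edges G"
  shows "graph_iso f (delete_edge G e) (delete_edge H (f ` e))"
proof -
  have "inj_on ((`) f) (edges G)"
    using assms by (auto intro!: inj_onI simp: simple_graph_def graph_iso_def bij_betw_def inj_on_image_eq_iff)
  then have "(`) f ` (edges G - {e}) = (`) f ` edges G - {f ` e}"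
    using assms(3) by (auto simp: inj_on_def)
  with assms(2) show ?thesis unfolding graph_iso_def by simp
qed

text \<open>In a simple graph only \<open>{x, y}\<close> itself contains both ends, so the adjacent
  edges split into two disjoint stars of the card. The edge degree thus turns into a condition on
  the ends of the edge to be restored.\<close>

lemma edge_degree_eq:
  assumes "simple_graph G" "{x, y} \<in> edges G" "x \<noteq> y"
  shows "edge_degree G {x, y} = degree (delete_edge G {x, y}) x + degree (delete_edge G {x, y}) y"
proof -
  let ?A = "\<lambda>x'. {e \<in> edges G - {{x, y}}. x' \<in> e}"
  have "e = {x, y}" if "e \<in> edges G" "x \<in> e" "y \<in> e" for e
    using simple_graph_edgeE[OF assms(1) that(1)] that assms(3) by (metis doubleton_eq_iff empty_iff insertE)
  then have "?A x \<inter> ?A y = {}" by blast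
  moreover have "{e' \<in> edges G. e' \<noteq> {x, y} \<and> e' \<inter> {x, y} \<noteq> {}} = ?A x \<union> ?A y" by blast
  ultimately show ?thesis using simple_graph_finite_edges[OF assms(1)]
    by (simp add: edge_degree_def degree_def card_Un_disjoint)
qed

lemma unlabeled_cong:
  assumes "simple_graph G" "simple_graph H" "isomorphic G H"
  shows "unlabeled G = unlabeled H"
  unfolding unlabeled_def
  using isomorphic_trans[OF assms(3)] isomorphic_trans[OF isomorphic_sym[OF assms]] by blast

lemma da_ecard_iso:
  assumes "simple_graph G" "simple_graph H" "graph_iso f G H" "e \<in> edges G"
  shows "da_ecard H (f ` e) = da_ecard G e"
proof -
  obtain x y where e: "e = {x, y}" "x \<noteq> y" "x \<in> verts G" "y \<in> verts G"
    using simple_graph_edgeE[OF assms(1,4)] .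
  have fe: "f ` e = {f x, f y}" "f ` e \<in> edges H"
    using e(1) imageI[OF assms(4), of "(`) f"] assms(3) by (auto simp: graph_iso_def)
  have "f x \<noteq> f y" using e assms(3) unfolding graph_iso_def bij_betw_def by (auto dest: inj_onD)
  have iso: "graph_iso f (delete_edge G e) (delete_edge H (f ` e))"
    using assms graph_iso_delete_edge by blast
  have "edge_degree H (f ` e) = edge_degree G e"
    using edge_degree_eq[of G x y] edge_degree_eq[of H "f x" "f y"] iso e fe \<open>f x \<noteq> f y\<close> assms
      graph_iso_degree[OF simple_graph_delete_edge[OF assms(1)] iso] by simp
  moreover have "isomorphic (delete_edge G e) (delete_edge H (f ` e))"
    using iso isomorphic_iff_graph_iso simple_graph_delete_edge[OF assms(1)]
      simple_graph_delete_edge[OF assms(2)] by blast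
  then have "unlabeled (delete_edge H (f ` e)) = unlabeled (delete_edge G e)"
    using unlabeled_cong simple_graph_delete_edge[OF assms(1)]
      simple_graph_delete_edge[OF assms(2)] by blast
  ultimately show ?thesis by (simp add: da_ecard_def)
qed

section \<open>Decks and \<open>dern\<close> as isomorphism invariants\<close>

lemma da_edeck_cong:
  assumes "simple_graph G" "simple_graph H" "isomorphic G H"
  shows "da_edeck G = da_edeck H"
proof -
  obtain f where f: "graph_iso f G H" using assms isomorphic_iff_graph_iso by blast
  have "inj_on ((`) f) (edges G)"
    using assms f by (auto intro!: inj_onI simp: simple_graph_def graph_iso_def bij_betw_def inj_on_image_eq_iff)
  then have "mset_set (edges H) = image_mset ((`) f) (mset_set (edges G))"
    using f by (simp add: image_mset_mset_set graph_iso_def)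
  then have "da_edeck H = image_mset (\<lambda>e. da_ecard H (f ` e)) (mset_set (edges G))"
    by (simp add: da_edeck_def image_mset.compositionality comp_def)
  also have "\<dots> = da_edeck G"
    unfolding da_edeck_def using da_ecard_iso[OF assms(1,2) f] simple_graph_finite_edges[OF assms(1)]
    by (intro image_mset_cong) auto
  finally show ?thesis ..
qed

text \<open>The two graphs may have different vertex types, since competitors always live on natural
  numbers; this lets a broom be replaced by a concrete copy.\<close>

lemma dern_cong:
  assumes "simple_graph G" "simple_graph H" "isomorphic G H"
  shows "dern G = dern H"
proof -
  have "isomorphic K G \<longleftrightarrow> isomorphic K H" for K :: "nat graph"
    using isomorphic_trans[OF _ assms(3), of K] isomorphic_trans[OF _ isomorphic_sym[OF assms], of K]
    by blast
  then show ?thesis unfolding dern_def by (simp add: da_edeck_cong[OF assms])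
qed

section \<open>Lower and upper bounds for \<open>dern\<close>\<close>

lemma dern_ge_1:
  assumes "verts G \<noteq> {}" shows "1 \<le> dern G"
  unfolding dern_def
proof (rule Inf_greatest, clarify)
  fix S assume "\<not> (\<exists>H :: nat graph. simple_graph H \<and> \<not> isomorphic H G \<and> S \<subseteq># da_edeck H)"
  \<comment> \<open>The empty graph competes for the empty multiset, so a determining
    \<open>S\<close> has an element.\<close>
  moreover have "simple_graph (Graph {} {} :: nat graph)" "\<not> isomorphic (Graph {} {} :: nat graph) G"
    using assms by (auto simp: simple_graph_def isomorphic_def bij_betw_def)
  ultimately have "S \<noteq> {#}" by (metis empty_le)
  then have "1 \<le> size S" by (cases S) auto
  then show "1 \<le> enat (size S)" by (simp add: one_enat_def)
qed

text \<open>A graph with the cards of \<open>e\<close> and \<open>e'\<close> arises from the first card by adding an edge \<open>{x, y}\<close>;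
  \<open>\<psi>\<close> embeds the second card into it.\<close>

lemma dern_le_2:
  fixes G :: "'a graph"
  assumes G: "simple_graph G" and e: "e \<in> edges G" "e' \<in> edges G" "e \<noteq> e'"
    and key: "\<And>x y \<psi>. \<lbrakk>x \<in> verts G; y \<in> verts G; x \<noteq> y;
        degree (delete_edge G e) x + degree (delete_edge G e) y = edge_degree G e;
        bij_betw \<psi> (verts G) (verts G);
        \<And>d. d \<in> edges G - {e'} \<Longrightarrow> \<psi> ` d \<in> insert {x, y} (edges G - {e})\<rbrakk>
      \<Longrightarrow> isomorphic (Graph (verts G) (insert {x, y} (edges G - {e}))) G"
  shows "dern G \<le> 2"
proof -
  let ?S = "image_mset (da_ecard G) {#e, e'#}"
  have "mset_set {e, e'} \<subseteq># mset_set (edges G)"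
    using e simple_graph_finite_edges[OF G] by (intro subset_imp_msubset_mset_set) auto
  then have sub: "?S \<subseteq># da_edeck G"
    using e(3) unfolding da_edeck_def by (intro image_mset_subseteq_mono) simp
  have "isomorphic H G" if H: "simple_graph H" and "?S \<subseteq># da_edeck H" for H :: "nat graph"
  proof -
    have "da_ecard G e \<in># da_edeck H" "da_ecard G e' \<in># da_edeck H"
      using that(2) by (auto dest: mset_subset_eqD)
    then obtain f f' where f: "f \<in> edges H" "da_ecard H f = da_ecard G e"
        and f': "f' \<in> edges H" "da_ecard H f' = da_ecard G e'"
      unfolding da_edeck_def using simple_graph_finite_edges[OF H] by force
    have card_iso: "\<exists>h. graph_iso h (delete_edge H a) (delete_edge G b)"
      if "da_ecard H a = da_ecard G b" for a b
    proof -
      \<comment> \<open>\<open>H\<close> lives on natural numbers, so its own card belongs to the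
        class that represents it.\<close>
      have "delete_edge H a \<in> unlabeled (delete_edge H a)"
        using simple_graph_delete_edge[OF H] isomorphic_refl by (auto simp: unlabeled_def)
      then have "delete_edge H a \<in> unlabeled (delete_edge G b)" using that by (simp add: da_ecard_def)
      then have "isomorphic (delete_edge H a) (delete_edge G b)"
        using simple_graph_delete_edge[OF G] isomorphic_sym by (auto simp: unlabeled_def)
      then show ?thesis
        using simple_graph_delete_edge[OF G] simple_graph_delete_edge[OF H] isomorphic_iff_graph_iso by blast
    qed
    obtain h where h: "graph_iso h (delete_edge H f) (delete_edge G e)" using card_iso[OF f(2)] by blast
    obtain h' where "graph_iso h' (delete_edge H f') (delete_edge G e')" using card_iso[OF f'(2)] by blast
    then obtain g where g: "graph_iso g (delete_edge G e') (delete_edge H f')"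
      using graph_iso_sym simple_graph_delete_edge[OF H] by blast
    obtain x' y' where xy': "f = {x', y'}" "x' \<noteq> y'" "x' \<in> verts H" "y' \<in> verts H"
      using simple_graph_edgeE[OF H f(1)] .
    define x y where "x = h x'" and "y = h y'"
    have hb: "bij_betw h (verts H) (verts G)" and he: "(`) h ` (edges H - {f}) = edges G - {e}"
      using h by (auto simp: graph_iso_def)
    have xy: "x \<in> verts G" "y \<in> verts G" "x \<noteq> y"
      using hb xy' unfolding x_def y_def bij_betw_def by (auto dest: inj_onD)
    \<comment> \<open>Carried to the vertices of \<open>G\<close> by \<open>h\<close>, the
      competitor is the first card plus the edge \<open>{x, y}\<close>.\<close>
    have edges: "(`) h ` edges H = insert {x, y} (edges G - {e})"
    proof -
      have "(`) h ` edges H = insert (h ` f) ((`) h ` (edges H - {f}))" using f(1) by blast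
      with he xy'(1) show ?thesis by (simp add: x_def y_def)
    qed
    let ?K = "Graph (verts G) (insert {x, y} (edges G - {e}))"
    have "degree (delete_edge G e) (h z) = degree (delete_edge H f) z" if "z \<in> verts H" for z
      using graph_iso_degree[OF simple_graph_delete_edge[OF H] h] that by simp
    then have "degree (delete_edge G e) x + degree (delete_edge G e) y = edge_degree H f"
      unfolding x_def y_def using edge_degree_eq[OF H, of x' y'] f(1) xy' by metis
    also have "\<dots> = edge_degree G e" using f(2) by (simp add: da_ecard_def)
    finally have deg: "degree (delete_edge G e) x + degree (delete_edge G e) y = edge_degree G e" .
    \<comment> \<open>The second card enters \<open>H\<close> through \<open>g\<close> and then
      moves along with it by \<open>h\<close>.\<close>
    have "bij_betw (h \<circ> g) (verts G) (verts G)"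
      using g hb by (auto simp: graph_iso_def intro: bij_betw_trans)
    moreover have "(h \<circ> g) ` d \<in> insert {x, y} (edges G - {e})" if "d \<in> edges G - {e'}" for d
    proof -
      have "g ` d \<in> edges H"
        using g imageI[OF that, of "(`) g"] by (simp add: graph_iso_def)
      then have "h ` g ` d \<in> (`) h ` edges H" by (rule imageI)
      then show ?thesis unfolding edges image_comp .
    qed
    ultimately have "isomorphic ?K G" by (rule key[OF xy deg])
    moreover have "isomorphic H ?K"
    proof -
      have "simple_graph ?K" using G xy by (auto simp: simple_graph_def)
      then show ?thesis
        unfolding isomorphic_iff_graph_iso[OF H \<open>simple_graph ?K\<close>] graph_iso_def
        using hb edges by auto
    qed
    ultimately show ?thesis by (rule isomorphic_trans[rotated])
  qed
  then have "dern G \<le> enat (size ?S)"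
    unfolding dern_def using sub by (intro Inf_lower) blast
  then show ?thesis by (simp add: numeral_eq_enat eval_nat_numeral)
qed

text \<open>No vertex of the second card is isolated, so some edge of it is mapped onto an edge at
  \<open>w\<close>. As the first card isolates \<open>w\<close>, that edge is the restored one. The
  degree of \<open>w\<close> in the card is \<open>0\<close>, hence the other end has the degree
  that \<open>v\<close> has there.\<close>

lemma dern_le_2_pendant:
  fixes G :: "'a graph"
  assumes G: "simple_graph G" and e': "e' \<in> edges G"
    and vw: "{v, w} \<in> edges G" "v \<noteq> w" and pendant: "\<And>d. d \<in> edges G \<Longrightarrow> w \<in> d \<Longrightarrow> d = {v, w}"
    and cover: "verts G \<subseteq> \<Union> (edges G - {e'})"
    and key: "\<And>y \<psi>. \<lbrakk>y \<in> verts G; y \<noteq> w;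
        degree (delete_edge G {v, w}) y = degree (delete_edge G {v, w}) v;
        bij_betw \<psi> (verts G) (verts G);
        \<And>d. d \<in> edges G - {e'} \<Longrightarrow> \<psi> ` d \<in> insert {y, w} (edges G - {{v, w}})\<rbrakk>
      \<Longrightarrow> isomorphic (Graph (verts G) (insert {y, w} (edges G - {{v, w}}))) G"
  shows "dern G \<le> 2"
proof (rule dern_le_2[OF G vw(1) e'])
  have w: "w \<in> verts G" using vw G by (auto simp: simple_graph_def)
  \<comment> \<open>\<open>w\<close> must be covered by an edge other than \<open>e'\<close>, and
    \<open>{v, w}\<close> is the only edge at \<open>w\<close>.\<close>
  show "{v, w} \<noteq> e'" using pendant cover w by blast
  fix x y \<psi>
  let ?E = "insert {x, y} (edges G - {{v, w}})" and ?G = "delete_edge G {v, w}"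
  assume xy: "x \<in> verts G" "y \<in> verts G" "x \<noteq> y"
    and deg: "degree ?G x + degree ?G y = edge_degree G {v, w}"
    and bij: "bij_betw \<psi> (verts G) (verts G)"
    and sub: "\<And>d. d \<in> edges G - {e'} \<Longrightarrow> \<psi> ` d \<in> ?E"
  obtain z where "z \<in> verts G" "w = \<psi> z" using bij w unfolding bij_betw_def by blast
  then obtain d where "d \<in> edges G - {e'}" "w \<in> \<psi> ` d" using cover by blast
  then have "w \<in> {x, y}" using sub pendant by blast
  have "degree ?G w = 0"
    using pendant by (auto simp: degree_def card_eq_0_iff)
  then have dv: "edge_degree G {v, w} = degree ?G v" using edge_degree_eq[OF G vw] by simp
  show "isomorphic (Graph (verts G) ?E) G"
  proof (cases "w = x")
    case True
    with key[of y \<psi>] xy deg bij sub dv \<open>degree ?G w = 0\<close> show ?thesis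
      by (auto simp: insert_commute)
  next
    case False
    with key[of x \<psi>] xy deg bij sub dv \<open>degree ?G w = 0\<close> \<open>w \<in> {x, y}\<close> show ?thesis by auto
  qed
qed

section \<open>Cycles with two pendant vertices\<close>

definition cycle_edges :: "nat \<Rightarrow> nat set set" where
  "cycle_edges c = (\<lambda>i. {i, Suc i mod c}) ` {..<c}"

text \<open>Normal form of a broom with two paths and one leaf at each hub: the hubs are
  \<open>0\<close> and \<open>p\<close> on the cycle \<open>{..<c}\<close>, their leaves
  \<open>c\<close> and \<open>c + 1\<close>.\<close>

definition bipendant_cycle :: "nat \<Rightarrow> nat \<Rightarrow> nat graph" where
  "bipendant_cycle c p = Graph {..<c + 2} (insert {p, c + 1} (insert {0, c} (cycle_edges c)))"

lemma Suc_mod_if: "i < c \<Longrightarrow> Suc i mod c = (if Suc i = c then 0 else Suc i)"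
  by (simp add: mod_Suc)

text \<open>With the modulus resolved into wrap-around cases, membership becomes linear
  arithmetic.\<close>

lemma cycle_edges_iff:
  assumes "2 \<le> c"
  shows "{a, b} \<in> cycle_edges c \<longleftrightarrow> a < c \<and> b < c \<and>
    (b = Suc a \<or> a = Suc b \<or> a = 0 \<and> b = c - 1 \<or> a = c - 1 \<and> b = 0)"
    (is "_ \<longleftrightarrow> ?R")
proof
  assume "{a, b} \<in> cycle_edges c"
  then show ?R using assms by (auto simp: cycle_edges_def doubleton_eq_iff Suc_mod_if split: if_splits)
next
  have "{i, Suc i mod c} \<in> cycle_edges c" if "i < c" for i using that by (auto simp: cycle_edges_def)
  from this[of a] this[of b] this[of "c - 1"] assms
  show "?R \<Longrightarrow> {a, b} \<in> cycle_edges c" by (auto simp: Suc_mod_if insert_commute split: if_splits)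
qed

lemma cycle_edges_subset:
  assumes "d \<in> cycle_edges c" shows "d \<subseteq> {..<c}"
  using assms by (auto simp: cycle_edges_def)

lemma simple_bipendant_cycle:
  assumes "2 \<le> c" "p < c" shows "simple_graph (bipendant_cycle c p)"
  using assms by (auto simp: simple_graph_def bipendant_cycle_def cycle_edges_def card_insert_if Suc_mod_if)

text \<open>Reversing the cycle about the hub \<open>0\<close> fixes \<open>0\<close> and both
  leaves and exchanges \<open>y\<close> with \<open>c - y\<close>; the reversal is its own
  inverse.\<close>

lemma bipendant_cycle_reflect:
  assumes c: "3 \<le> c" and y: "0 < y" "y < c"
  shows "isomorphic (bipendant_cycle c (c - y)) (bipendant_cycle c y)"
proof -
  define f where "f i = (if 0 < i \<and> i < c then c - i else i)" for i
  have cyc: "f ` d \<in> cycle_edges c" if d: "d \<in> cycle_edges c" for d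
  proof -
    obtain i where i: "i < c" "d = {i, Suc i mod c}" using d unfolding cycle_edges_def by blast
    have "{f i, f (Suc i mod c)} \<in> cycle_edges c"
      using i c by (auto simp: cycle_edges_iff f_def Suc_mod_if)
    then show ?thesis using i by simp
  qed
  have "graph_iso f (bipendant_cycle c (c - y)) (bipendant_cycle c y)"
  proof (rule graph_iso_byWitness[where g = f])
    fix d assume d: "d \<in> edges (bipendant_cycle c y)"
    then have "f ` d \<in> edges (bipendant_cycle c (c - y))"
      using cyc[of d] y by (auto simp: bipendant_cycle_def f_def)
    with d show "d \<subseteq> verts (bipendant_cycle c y) \<and> f ` d \<in> edges (bipendant_cycle c (c - y))"
      using simple_bipendant_cycle[of c y] c y by (auto simp: simple_graph_def)
  next
    fix d assume "d \<in> edges (bipendant_cycle c (c - y))"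
    then show "f ` d \<in> edges (bipendant_cycle c y)"
      using cyc[of d] y by (auto simp: bipendant_cycle_def f_def)
  qed (auto simp: bipendant_cycle_def f_def)
  then show ?thesis
    using isomorphic_iff_graph_iso[of "bipendant_cycle c (c - y)" "bipendant_cycle c y"]
      simple_bipendant_cycle[of c] c y by auto
qed

text \<open>An injective walk on a cycle cannot turn back, so its first step fixes the direction,
  and \<open>p\<close> steps from \<open>0\<close> end at \<open>p\<close> or at \<open>-p\<close>
  modulo \<open>c\<close>.\<close>

lemma path_in_cycle:
  fixes z :: "nat \<Rightarrow> nat"
  assumes c: "p < c" and z0: "z 0 = 0" and inj: "inj_on z {..p}"
    and step: "\<And>i. i < p \<Longrightarrow> {z i, z (Suc i)} \<in> cycle_edges c"
  shows "z p = p \<or> z p = (c - p) mod c"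
proof (cases "c \<le> 1")
  case True
  with c have "p = 0" by simp
  with z0 show ?thesis by simp
next
  case False
  then have step: "z i < c \<and> z (Suc i) < c \<and> 
      (z (Suc i) = Suc (z i) \<or> z i = Suc (z (Suc i)) \<or> z i = 0 \<and> z (Suc i) = c - 1 \<or> z i = c - 1 \<and> z (Suc i) = 0)"
    if "i < p" for i using step[OF that] cycle_edges_iff[of c] by simp
  \<comment> \<open>Injectivity forbids returning to the previous vertex.\<close>
  have ne: "z (i - 1) \<noteq> z (Suc i)" if "0 < i" "i < p" for i
    using inj_on_eq_iff[OF inj, of "i - 1" "Suc i"] that by simp
  \<comment> \<open>The whole prefix enters the induction, since the last two vertices decide the
    next one.\<close>
  have "j \<le> p \<Longrightarrow> (\<forall>i\<le>j. z i = i) \<or> (\<forall>i\<le>j. z i = (c - i) mod c)" for j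
  proof (induction j)
    case 0
    then show ?case using z0 by simp
  next
    case (Suc j)
    then have j: "j < p" and IH: "(\<forall>i\<le>j. z i = i) \<or> (\<forall>i\<le>j. z i = (c - i) mod c)" by auto
    have "z (Suc j) = Suc j \<or> z (Suc j) = (c - Suc j) mod c" if "j = 0"
      using step[OF j] that z0 False by (auto simp: Suc_mod_if split: if_splits)
    moreover have "z (Suc j) = Suc j" if "0 < j" "\<forall>i\<le>j. z i = i"
      using step[OF j] ne[OF that(1) j] that j c by (auto simp: Suc_mod_if split: if_splits)
    moreover have "z (Suc j) = (c - Suc j) mod c" if "0 < j" "\<forall>i\<le>j. z i = (c - i) mod c"
    proof -
      \<comment> \<open>\<open>(c - i) mod c\<close> wraps to \<open>0\<close> at
        \<open>i = 0\<close>, so the predecessor needs its own case for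
        \<open>j = 1\<close>.\<close>
      have "z j = c - j" "z (j - 1) = (if j = 1 then 0 else c - (j - 1))" using that j c by auto
      then show ?thesis
        using step[OF j] ne[OF that(1) j] that j c by (auto simp: Suc_mod_if split: if_splits)
    qed
    ultimately show ?case using IH z0 by (cases "j = 0") (auto simp: le_Suc_eq)
  qed
  from this[of p] show ?thesis by auto
qed

section \<open>Embeddings of a card into a cycle with two leaves\<close>

lemma bipendant_cycle_edge_iff:
  assumes "2 \<le> c" "y < c"
  shows "{a, b} \<in> edges (bipendant_cycle c y) \<longleftrightarrow>
    a < c \<and> b < c \<and> (b = Suc a \<or> a = Suc b \<or> a = 0 \<and> b = c - 1 \<or> a = c - 1 \<and> b = 0)
    \<or> a = 0 \<and> b = c \<or> a = c \<and> b = 0 \<or> a = y \<and> b = c + 1 \<or> a = c + 1 \<and> b = y"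
  unfolding bipendant_cycle_def using assms cycle_edges_iff[OF assms(1)] by (auto simp: doubleton_eq_iff)

text \<open>A cycle vertex that carries no leaf has only its two neighbours on the cycle, and a leaf
  has one; so three neighbours single out the hubs.\<close>

lemma bipendant_cycle_three_nbrs:
  assumes "3 \<le> c" "y < c" and "distinct [b1, b2, b3]"
    and "{a, b1} \<in> edges (bipendant_cycle c y)" "{a, b2} \<in> edges (bipendant_cycle c y)"
      "{a, b3} \<in> edges (bipendant_cycle c y)"
  shows "a = 0 \<or> a = y"
proof (rule ccontr)
  assume a: "\<not> (a = 0 \<or> a = y)"
  have "a < c \<and> (b = Suc a mod c \<or> b = a - 1) \<or> a = c \<and> b = 0 \<or> a = c + 1 \<and> b = y"
    if "{a, b} \<in> edges (bipendant_cycle c y)" for b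
    using that a assms(1,2) by (auto simp: bipendant_cycle_edge_iff Suc_mod_if)
  from this[OF assms(4)] this[OF assms(5)] this[OF assms(6)] assms(1,2,3) show False by auto
qed

text \<open>Leaves have one neighbour each, so a second neighbour places \<open>a\<close> on the
  cycle.\<close>

lemma bipendant_cycle_two_nbrs:
  assumes "3 \<le> c" "y < c" and "b1 \<noteq> b2"
    and "{a, b1} \<in> edges (bipendant_cycle c y)" "{a, b2} \<in> edges (bipendant_cycle c y)"
  shows "a < c"
  using assms by (auto simp: bipendant_cycle_edge_iff)

text \<open>The deleted edge lies beyond \<open>p\<close> and avoids both hubs. So the hubs keep
  three neighbours and go to \<open>0\<close> and \<open>y\<close> in some order, while the
  surviving path from \<open>0\<close> to \<open>p\<close> goes to a path on the cycle. Its length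
  \<open>p\<close> leaves only two positions for \<open>y\<close>.\<close>

lemma embedding_into_bipendant_cycle:
  fixes \<psi> :: "nat \<Rightarrow> nat"
  assumes c: "0 < p" "p + 2 < c" and y: "0 < y" "y < c"
    and inj: "inj_on \<psi> {..<c + 2}"
    and emb: "\<And>d. d \<in> edges (bipendant_cycle c p) - {{Suc p, Suc (Suc p)}}
      \<Longrightarrow> \<psi> ` d \<in> edges (bipendant_cycle c y)"
  shows "y = p \<or> y = c - p"
proof -
  have c3: "3 \<le> c" using c by simp
  let ?E = "edges (bipendant_cycle c y)"
  have E: "{\<psi> a, \<psi> b} \<in> ?E"
    if "{a, b} \<in> edges (bipendant_cycle c p)" "{a, b} \<noteq> {Suc p, Suc (Suc p)}" for a b
    using emb[of "{a, b}"] that by simp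
  \<comment> \<open>The range includes \<open>i = p\<close>: the edge just before the deleted one
    supplies a third neighbour of \<open>p\<close>.\<close>
  have step: "{\<psi> i, \<psi> (Suc i)} \<in> ?E" if "i \<le> p" for i
    using E[of i "Suc i"] that c by (simp add: bipendant_cycle_edge_iff doubleton_eq_iff)
  have pend: "{\<psi> 0, \<psi> (c - 1)} \<in> ?E" "{\<psi> 0, \<psi> c} \<in> ?E" "{\<psi> p, \<psi> (c + 1)} \<in> ?E"
    using E[of 0 "c - 1"] E[of 0 c] E[of p "c + 1"] c
    by (simp_all add: bipendant_cycle_edge_iff doubleton_eq_iff)
  have ne: "\<psi> i \<noteq> \<psi> j" if "i \<noteq> j" "i < c + 2" "j < c + 2" for i j
    using inj that by (auto dest: inj_onD)
  have "distinct [\<psi> 1, \<psi> (c - 1), \<psi> c]" using ne c by auto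
  then have end0: "\<psi> 0 = 0 \<or> \<psi> 0 = y"
    using bipendant_cycle_three_nbrs[OF c3 y(2), of "\<psi> 1" "\<psi> (c - 1)" "\<psi> c" "\<psi> 0"] pend step[of 0] by simp
  have pred: "{\<psi> i, \<psi> (i - 1)} \<in> ?E" if "0 < i" "i \<le> p" for i
    using step[of "i - 1"] that by (simp add: insert_commute)
  have "distinct [\<psi> (p - 1), \<psi> (Suc p), \<psi> (c + 1)]" using ne c by auto
  then have endp: "\<psi> p = 0 \<or> \<psi> p = y"
    using bipendant_cycle_three_nbrs[OF c3 y(2) _ pred[of p] step[of p] pend(3)] c by simp
  \<comment> \<open>Interior vertices of the path and \<open>p\<close> keep two neighbours, so none
    of them goes to a leaf.\<close>
  have less: "\<psi> i < c" if "i \<le> p" for i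
  proof (cases "i = 0")
    case True
    with end0 y show ?thesis by auto
  next
    case False
    then show ?thesis
      using bipendant_cycle_two_nbrs[OF c3 y(2) _ pred[of i] step[of i]] ne[of "i - 1" "Suc i"] that c by simp
  qed
  have path: "{\<psi> i, \<psi> (Suc i)} \<in> cycle_edges c" if "i < p" for i
  proof -
    have "\<psi> i < c" "\<psi> (Suc i) < c" using less that by simp_all
    then show ?thesis using step[of i] that by (auto simp: bipendant_cycle_def doubleton_eq_iff)
  qed
  have "\<psi> 0 \<noteq> \<psi> p" using ne c by simp
  then consider "\<psi> 0 = 0" "\<psi> p = y" | "\<psi> 0 = y" "\<psi> p = 0" using end0 endp by auto
  then show ?thesis
  proof cases
    case 1
    have "inj_on \<psi> {..p}" by (rule inj_on_subset[OF inj]) (use c in auto)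
    then show ?thesis using path_in_cycle[of p c \<psi>] path c 1 by auto
  next
    case 2
    \<comment> \<open>When the hubs are exchanged, the path is read backwards so that its image
      starts at \<open>0\<close>.\<close>
    have "inj_on (\<lambda>i. \<psi> (p - i)) {..p}" 
    proof (rule inj_onI)
      fix i j assume "i \<in> {..p}" "j \<in> {..p}" "\<psi> (p - i) = \<psi> (p - j)"
      moreover have "p - i < c + 2" "p - j < c + 2" using c by simp_all
      ultimately have "p - i = p - j" using ne by blast
      with \<open>i \<in> {..p}\<close> \<open>j \<in> {..p}\<close> show "i = j" by auto
    qed
    moreover have "{\<psi> (p - i), \<psi> (p - Suc i)} \<in> cycle_edges c" if "i < p" for i
      using path[of "p - Suc i"] that by (simp add: insert_commute Suc_diff_Suc)
    ultimately show ?thesis using path_in_cycle[of p c "\<lambda>i. \<psi> (p - i)"] c 2 by auto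
  qed
qed

text \<open>In the graph without \<open>{1, 2}\<close>, the edge \<open>{2, 5}\<close> is disjoint
  from \<open>0\<close> and its three neighbours. In the target the hubs \<open>0\<close> and
  \<open>y\<close> are adjacent, and every edge meets the closed neighbourhood of each hub, so
  \<open>{2, 5}\<close> has no place to go.\<close>

lemma no_embedding_into_bipendant_cycle_4:
  fixes \<psi> :: "nat \<Rightarrow> nat"
  assumes y: "y = 1 \<or> y = 3" and bij: "bij_betw \<psi> {..<6} {..<6}"
    and emb: "\<And>d. d \<in> edges (bipendant_cycle 4 2) - {{1, 2}} \<Longrightarrow> \<psi> ` d \<in> edges (bipendant_cycle 4 y)"
  shows False
proof -
  have E: "edges (bipendant_cycle 4 p) = {{p, 5}, {0, 4}, {0, 1}, {1, 2}, {2, 3}, {3, 0}}" for p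
  proof -
    have "{..<4::nat} = {0, 1, 2, 3}" by auto
    moreover have "Suc 0 mod 4 = 1" "Suc 1 mod 4 = 2" "Suc 2 mod 4 = 3" "Suc 3 mod 4 = 0" "4 + 1 = (5 :: nat)"
      by simp_all
    ultimately show ?thesis
      by (simp only: bipendant_cycle_def graph.sel cycle_edges_def image_insert image_empty)
  qed
  have e: "{\<psi> 0, \<psi> 1} \<in> edges (bipendant_cycle 4 y)" "{\<psi> 0, \<psi> 3} \<in> edges (bipendant_cycle 4 y)"
      "{\<psi> 0, \<psi> 4} \<in> edges (bipendant_cycle 4 y)" "{\<psi> 2, \<psi> 5} \<in> edges (bipendant_cycle 4 y)"
    using emb[of "{0, 1}"] emb[of "{3, 0}"] emb[of "{0, 4}"] emb[of "{2, 5}"]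
    unfolding E by (auto simp: doubleton_eq_iff insert_commute)
  have ne: "\<psi> i \<noteq> \<psi> j" if "i \<noteq> j" "i < 6" "j < 6" for i j
    using bij that by (auto simp: bij_betw_def dest: inj_onD)
  \<comment> \<open>Three distinct images fill a set of size 3, so the remaining vertices
    \<open>2\<close> and \<open>5\<close> go outside it.\<close>
  have out: "\<psi> 2 \<notin> insert (\<psi> 0) N" "\<psi> 5 \<notin> insert (\<psi> 0) N"
    if "card N = 3" "{\<psi> 1, \<psi> 3, \<psi> 4} \<subseteq> N" for N
  proof -
    have "card {\<psi> 1, \<psi> 3, \<psi> 4} = 3" using ne by simp
    then have "N = {\<psi> 1, \<psi> 3, \<psi> 4}" using that by (metis card_subset_eq card.infinite zero_neq_numeral)
    then show "\<psi> 2 \<notin> insert (\<psi> 0) N" "\<psi> 5 \<notin> insert (\<psi> 0) N" using ne by auto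
  qed
  have "distinct [\<psi> 1, \<psi> 3, \<psi> 4]" using ne by simp
  then consider "\<psi> 0 = 0" | "\<psi> 0 = y"
    using bipendant_cycle_three_nbrs[OF _ _ _ e(1-3)] y by auto
  then show False
  proof cases
    case 1
    have "b \<in> {1, 3, 4}" if "{0, b} \<in> edges (bipendant_cycle 4 y)" for b
      using that y unfolding E by (auto simp: doubleton_eq_iff)
    with e 1 have "{\<psi> 1, \<psi> 3, \<psi> 4} \<subseteq> {1, 3, 4}" by simp
    note out = out[OF _ this, unfolded 1]
    have "a \<in> {0, 1, 3, 4} \<or> b \<in> {0, 1, 3, 4}" if "{a, b} \<in> edges (bipendant_cycle 4 y)" for a b
      using that y unfolding E by (auto simp: doubleton_eq_iff)
    from this[OF e(4)] out show False by simp
  next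
    case 2
    have "b \<in> {0, 2, 5}" if "{y, b} \<in> edges (bipendant_cycle 4 y)" for b
      using that y unfolding E by (auto simp: doubleton_eq_iff)
    with e 2 have "{\<psi> 1, \<psi> 3, \<psi> 4} \<subseteq> {0, 2, 5}" by simp
    note out = out[OF _ this, unfolded 2]
    have "a \<in> {y, 0, 2, 5} \<or> b \<in> {y, 0, 2, 5}" if "{a, b} \<in> edges (bipendant_cycle 4 y)" for a b
      using that y unfolding E by (auto simp: doubleton_eq_iff)
    from this[OF e(4)] out show False by simp
  qed
qed

text \<open>\<open>p\<close> is the length of a shortest path between the hubs. Without the pendant
  edge \<open>p\<close> has degree 2, so the leaf returns to a cycle vertex \<open>y\<close> other
  than \<open>0\<close>, and the second card leaves only \<open>y = p\<close> and its mirror image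
  \<open>c - p\<close>.\<close>

lemma dern_bipendant_cycle:
  assumes p: "2 \<le> p" "2 * p \<le> c"
  shows "dern (bipendant_cycle c p) \<le> 2"
proof -
  let ?G = "bipendant_cycle c p"
  \<comment> \<open>On a 4-cycle with opposite hubs every cycle edge meets a hub; otherwise the path
    beyond \<open>p\<close> has an edge avoiding both.\<close>
  define e' where "e' = (if c = 4 then {1, 2} else {Suc p, Suc (Suc p)})"
  have c: "4 \<le> c" "p + 2 \<le> c" using p by auto
  have cp: "p + 2 < c" if "c \<noteq> 4" using p that c by auto
  have simple: "simple_graph ?G" using simple_bipendant_cycle c by simp
  have e': "e' \<in> cycle_edges c" using c cp by (auto simp: e'_def cycle_edges_iff)
  have pendant: "{p, c + 1} \<notin> cycle_edges c" "{p, c + 1} \<noteq> {0, c}"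
    using cycle_edges_subset[of "{p, c + 1}" c] by (auto simp: doubleton_eq_iff)
  then have E: "edges ?G - {{p, c + 1}} = insert {0, c} (cycle_edges c)"
    by (auto simp: bipendant_cycle_def)
  have comm: "{p, c + 1} = {c + 1, p}" by auto
  show ?thesis
  proof (rule dern_le_2_pendant[where v = p and w = "c + 1" and e' = e'])
    show "simple_graph ?G" by fact
    show "e' \<in> edges ?G" using e' by (simp add: bipendant_cycle_def)
    show "{p, c + 1} \<in> edges ?G" "p \<noteq> c + 1" using c by (auto simp: bipendant_cycle_def)
    show "d = {p, c + 1}" if "d \<in> edges ?G" "c + 1 \<in> d" for d
    proof -
      have "d \<notin> cycle_edges c" using that(2) cycle_edges_subset[of d c] by force
      then show ?thesis using that by (auto simp: bipendant_cycle_def)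
    qed
    show "verts ?G \<subseteq> \<Union> (edges ?G - {e'})"
    proof
      fix z assume "z \<in> verts ?G"
      then consider "z < c" | "z = c" | "z = c + 1" by (force simp: bipendant_cycle_def)
      then show "z \<in> \<Union> (edges ?G - {e'})"
      proof cases
        case 1
        \<comment> \<open>Each cycle vertex lies on two cycle edges, at most one of which is
          \<open>e'\<close>; \<open>z'\<close> is the cyclic predecessor.\<close>
        define z' where "z' = (if z = 0 then c - 1 else z - 1)"
        have "{z, Suc z mod c} \<in> edges ?G" "{z', z} \<in> edges ?G" "{z, Suc z mod c} \<noteq> {z', z}"
          using 1 c by (auto simp: bipendant_cycle_def cycle_edges_iff z'_def doubleton_eq_iff Suc_mod_if)
        then show ?thesis by blast
      next
        case 2
        then have "{0, c} \<in> edges ?G - {e'}" "z \<in> {0, c}"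
          using cycle_edges_subset[OF e'] by (auto simp: bipendant_cycle_def)
        then show ?thesis by blast
      next
        case 3
        then have "{p, c + 1} \<in> edges ?G - {e'}" "z \<in> {p, c + 1}"
          using cycle_edges_subset[OF e'] by (auto simp: bipendant_cycle_def)
        then show ?thesis by blast
      qed
    qed
    fix y \<psi>
    assume y: "y \<in> verts ?G" "y \<noteq> c + 1"
      and deg: "degree (delete_edge ?G {p, c + 1}) y = degree (delete_edge ?G {p, c + 1}) p"
      and bij: "bij_betw \<psi> (verts ?G) (verts ?G)"
      and emb: "\<And>d. d \<in> edges ?G - {e'} \<Longrightarrow> \<psi> ` d \<in> insert {y, c + 1} (edges ?G - {{p, c + 1}})"
    have degree: "degree (delete_edge ?G {p, c + 1}) z = card {d \<in> insert {0, c} (cycle_edges c). z \<in> d}" for z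
      by (simp only: degree_def edges_delete_edge E)
    have at: "{d \<in> cycle_edges c. z \<in> d} = {{z - 1, z}, {z, Suc z mod c}}" if "0 < z" "z < c" for z
      using that c by (auto simp: cycle_edges_def Suc_mod_if split: if_splits)
    have "{d \<in> insert {0, c} (cycle_edges c). c \<in> d} = {{0, c}}"
      using cycle_edges_subset by auto
    then have dc: "degree (delete_edge ?G {p, c + 1}) c = 1" unfolding degree by simp
    have "{d \<in> insert {0, c} (cycle_edges c). 0 \<in> d} = {{0, c}, {0, 1}, {c - 1, 0}}"
      using c by (auto simp: cycle_edges_def Suc_mod_if split: if_splits)
    then have d0: "degree (delete_edge ?G {p, c + 1}) 0 = 3"
      unfolding degree using c by (simp add: card_insert_if doubleton_eq_iff)
    have "{d \<in> insert {0, c} (cycle_edges c). p \<in> d} = {d \<in> cycle_edges c. p \<in> d}" using p c by auto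
    also have "\<dots> = {{p - 1, p}, {p, Suc p}}" using at[of p] p c by simp
    finally have "degree (delete_edge ?G {p, c + 1}) p = card {{p - 1, p}, {p, Suc p}}" unfolding degree by simp
    also have "{p - 1, p} \<noteq> {p, Suc p}" by (simp add: doubleton_eq_iff)
    then have "card {{p - 1, p}, {p, Suc p}} = 2" by simp
    finally have "degree (delete_edge ?G {p, c + 1}) p = 2" .
    with deg have dy: "degree (delete_edge ?G {p, c + 1}) y = 2" by (rule trans)
    have "y \<noteq> 0" by (rule notI) (use dy d0 in simp)
    moreover have "y \<noteq> c" by (rule notI) (use dy dc in simp)
    ultimately have yc: "0 < y" "y < c" using y by (auto simp: bipendant_cycle_def)
    \<comment> \<open>Moving the leaf stays within the family, with \<open>y\<close> in place of
      \<open>p\<close>.\<close>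
    have H: "Graph (verts ?G) (insert {y, c + 1} (edges ?G - {{p, c + 1}})) = bipendant_cycle c y"
      unfolding E by (simp add: bipendant_cycle_def)
    have emb: "\<psi> ` d \<in> edges (bipendant_cycle c y)" if "d \<in> edges ?G - {e'}" for d
      using emb[OF that] by (simp flip: H)
    have bij: "bij_betw \<psi> {..<c + 2} {..<c + 2}" using bij by (simp add: bipendant_cycle_def)
    have "y = p \<or> y = c - p"
    proof (cases "c = 4")
      case True
      then have "p = 2" using p by simp
      have "y \<noteq> 1 \<and> y \<noteq> 3"
        using no_embedding_into_bipendant_cycle_4[of y \<psi>] emb bij True \<open>p = 2\<close> by (auto simp: e'_def)
      with yc True \<open>p = 2\<close> show ?thesis by auto
    next
      case False
      then show ?thesis
        using embedding_into_bipendant_cycle[of p c y \<psi>] cp emb bij p yc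
        by (auto simp: e'_def bij_betw_def)
    qed
    then show "isomorphic (Graph (verts ?G) (insert {y, c + 1} (edges ?G - {{p, c + 1}}))) ?G"
      unfolding H using bipendant_cycle_reflect[of c p] isomorphic_refl c p by auto
  qed
qed

section \<open>Brooms\<close>

text \<open>A path is addressed by its length class \<open>i\<close> and its number \<open>j\<close>
  within the class.\<close>

definition broom_paths :: "nat \<Rightarrow> (nat \<Rightarrow> nat) \<Rightarrow> (nat \<times> nat) set" where
  "broom_paths t m = Sigma {1..t} (\<lambda>i. {1..m i})"

definition path_edge :: "(nat \<Rightarrow> nat) \<Rightarrow> nat \<Rightarrow> nat \<Rightarrow> nat \<Rightarrow> broom_vertex set" where
  "path_edge k i j l = {path_vertex k i j l, path_vertex k i j (l + 1)}"

lemma finite_broom_paths: "finite (broom_paths t m)"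
  by (simp add: broom_paths_def)

lemma card_broom_paths: "card (broom_paths t m) = (\<Sum>i=1..t. m i)"
  by (simp add: broom_paths_def)

lemma edges_broom_graph:
  "edges (broom_graph n1 n2 t m k) = (\<lambda>a. {HubU, LeafU a}) ` {1..n1} \<union> (\<lambda>b. {HubV, LeafV b}) ` {1..n2} \<union>
     {path_edge k i j l | i j l. (i, j) \<in> broom_paths t m \<and> 1 \<le> l \<and> l < k i}"
  by (auto simp: broom_graph_def broom_paths_def path_edge_def)

lemma edge_broom_graph_cases [consumes 1, case_names leafU leafV path]:
  assumes "d \<in> edges (broom_graph n1 n2 t m k)"
  obtains a where "d = {HubU, LeafU a}" "1 \<le> a" "a \<le> n1"
  | b where "d = {HubV, LeafV b}" "1 \<le> b" "b \<le> n2"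
  | i j l where "d = path_edge k i j l" "(i, j) \<in> broom_paths t m" "1 \<le> l" "l < k i"
  using assms unfolding edges_broom_graph by auto

lemma broom_graph_edge_intros:
  "1 \<le> a \<Longrightarrow> a \<le> n1 \<Longrightarrow> {HubU, LeafU a} \<in> edges (broom_graph n1 n2 t m k)"
  "1 \<le> b \<Longrightarrow> b \<le> n2 \<Longrightarrow> {HubV, LeafV b} \<in> edges (broom_graph n1 n2 t m k)"
  "(i, j) \<in> broom_paths t m \<Longrightarrow> 1 \<le> l \<Longrightarrow> l < k i \<Longrightarrow> path_edge k i j l \<in> edges (broom_graph n1 n2 t m k)"
  by (auto simp: edges_broom_graph)

text \<open>\<open>path_vertex\<close> repeats the hubs for every path; separating them off lets
  vertices be treated by constructor.\<close>

lemma verts_broom_graph: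
  assumes "\<forall>i\<in>{1..t}. k i > 2"
  shows "verts (broom_graph n1 n2 t m k) = {HubU, HubV} \<union> LeafU ` {1..n1} \<union> LeafV ` {1..n2} \<union>
     {Inner i j l | i j l. (i, j) \<in> broom_paths t m \<and> 2 \<le> l \<and> l < k i}" (is "_ = ?V")
proof
  show "verts (broom_graph n1 n2 t m k) \<subseteq> ?V"
    by (auto simp: broom_graph_def broom_paths_def path_vertex_def)
  have "Inner i j l \<in> verts (broom_graph n1 n2 t m k)"
    if "(i, j) \<in> broom_paths t m" "2 \<le> l" "l < k i" for i j l
  proof -
    have "Inner i j l = path_vertex k i j l" "i \<in> {1..t} \<and> j \<in> {1..m i} \<and> l \<in> {1..k i}"
      using that by (auto simp: path_vertex_def broom_paths_def)
    then show ?thesis unfolding broom_graph_def by auto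
  qed
  moreover have "{HubU, HubV} \<union> LeafU ` {1..n1} \<union> LeafV ` {1..n2} \<subseteq> verts (broom_graph n1 n2 t m k)"
    by (auto simp: broom_graph_def)
  ultimately show "?V \<subseteq> verts (broom_graph n1 n2 t m k)" by blast
qed

section \<open>Simplicity and reflection of brooms\<close>

lemma path_vertex_eq_Inner: "path_vertex k i j l = Inner i' j' l' \<Longrightarrow> i = i' \<and> j = j' \<and> l = l'"
  by (simp add: path_vertex_def split: if_splits)

lemma path_vertex_neq_leaf: "path_vertex k i j l \<noteq> LeafU a" "path_vertex k i j l \<noteq> LeafV b"
  by (simp_all add: path_vertex_def)

lemma leaf_notin_path_edge: "LeafU a \<notin> path_edge k i j l" "LeafV b \<notin> path_edge k i j l"
  by (simp_all add: path_edge_def path_vertex_neq_leaf[symmetric])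

lemma path_vertex_in_verts:
  assumes "(i, j) \<in> broom_paths t m" "1 \<le> l" "l \<le> k i"
  shows "path_vertex k i j l \<in> verts (broom_graph n1 n2 t m k)"
  using assms unfolding broom_graph_def broom_paths_def by auto

lemma broom_paths_length:
  "(i, j) \<in> broom_paths t m \<Longrightarrow> \<forall>i\<in>{1..t}. k i > 2 \<Longrightarrow> 2 < (k i :: nat)"
  by (auto simp: broom_paths_def)

lemma simple_broom_graph:
  assumes k: "\<forall>i\<in>{1..t}. k i > 2"
  shows "simple_graph (broom_graph n1 n2 t m k)"
proof -
  let ?V = "verts (broom_graph n1 n2 t m k)"
  have "{path_vertex k i j l | i j l. i \<in> {1..t} \<and> j \<in> {1..m i} \<and> l \<in> {1..k i}}
    = (\<lambda>((i, j), l). path_vertex k i j l) ` Sigma (broom_paths t m) (\<lambda>(i, j). {1..k i})"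
    by (force simp: broom_paths_def)
  moreover have "finite (Sigma (broom_paths t m) (\<lambda>(i, j). {1..k i}))"
    using finite_broom_paths by (intro finite_SigmaI) auto
  ultimately have "finite ?V" by (simp add: broom_graph_def)
  moreover have "d \<subseteq> ?V \<and> card d = 2" if "d \<in> edges (broom_graph n1 n2 t m k)" for d
    using that
  proof (cases rule: edge_broom_graph_cases)
    case (path i j l)
    then have "path_vertex k i j l \<noteq> path_vertex k i j (l + 1)"
      using broom_paths_length[OF path(2) k] by (auto simp: path_vertex_def)
    then show ?thesis
      using path path_vertex_in_verts[OF path(2), of l k] path_vertex_in_verts[OF path(2), of "l + 1" k]
      by (simp add: path_edge_def)
  qed (auto simp: broom_graph_def)
  ultimately show ?thesis by (simp add: simple_graph_def)
qed

text \<open>The leaf \<open>LeafV N\<close> is kept in place: for \<open>N = n2 = n1 + 1\<close> this is the leaf that moves from one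
  hub to the other, and \<open>N = 0\<close> gives the plain reflection, as no leaf is numbered \<open>0\<close>.\<close>

fun broom_reflect :: "(nat \<Rightarrow> nat) \<Rightarrow> nat \<Rightarrow> broom_vertex \<Rightarrow> broom_vertex" where
  "broom_reflect k N HubU = HubV"
| "broom_reflect k N HubV = HubU"
| "broom_reflect k N (LeafU a) = LeafV a"
| "broom_reflect k N (LeafV b) = (if b = N then LeafV b else LeafU b)"
| "broom_reflect k N (Inner i j l) = Inner i j (k i + 1 - l)"

text \<open>Position \<open>l\<close> goes to \<open>k i + 1 - l\<close>, so the reversed edge
  starts at the image of \<open>l + 1\<close>, which is \<open>k i - l\<close>.\<close>

lemma broom_reflect_path_edge:
  assumes "1 \<le> l" "l < k i"
  shows "broom_reflect k N ` path_edge k i j l = path_edge k i j (k i - l)"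
proof -
  have "broom_reflect k N (path_vertex k i j l) = path_vertex k i j (k i + 1 - l)"
    if "1 \<le> l" "l \<le> k i" "1 < k i" for l
    using that by (auto simp: path_vertex_def)
  from this[of l] this[of "l + 1"] assms show ?thesis
    by (simp add: path_edge_def insert_commute Suc_diff_le)
qed

text \<open>With \<open>N = 0\<close> the reflection moves every leaf and is its own inverse, so
  facts for arbitrary \<open>n1\<close> and \<open>n2\<close> serve both directions.\<close>

lemma graph_iso_broom_reflect:
  assumes k: "\<forall>i\<in>{1..t}. k i > 2"
  shows "graph_iso (broom_reflect k 0) (broom_graph n1 n2 t m k) (broom_graph n2 n1 t m k)"
proof -
  have verts: "broom_reflect k 0 x \<in> verts (broom_graph n2 n1 t m k) \<and> broom_reflect k 0 (broom_reflect k 0 x) = x"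
    if "x \<in> verts (broom_graph n1 n2 t m k)" for x n1 n2
    using that unfolding verts_broom_graph[OF k] by auto
  have edges: "broom_reflect k 0 ` d \<in> edges (broom_graph n2 n1 t m k)"
    if "d \<in> edges (broom_graph n1 n2 t m k)" for d n1 n2
    using that
  proof (cases rule: edge_broom_graph_cases)
    case (path i j l)
    then show ?thesis by (simp add: broom_reflect_path_edge broom_graph_edge_intros)
  qed (simp_all add: broom_graph_edge_intros)
  have sub: "d \<subseteq> verts (broom_graph n2 n1 t m k)" if "d \<in> edges (broom_graph n2 n1 t m k)" for d
    using simple_broom_graph[OF k] that by (auto simp: simple_graph_def)
  show ?thesis
    by (rule graph_iso_byWitness[where g = "broom_reflect k 0"]) (use verts edges sub in blast)+
qed

section \<open>Degrees of vertices in a broom\<close>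

lemma degree_HubU:
  assumes k: "\<forall>i\<in>{1..t}. k i > 2"
  shows "degree (broom_graph n1 n2 t m k) HubU = n1 + (\<Sum>i=1..t. m i)"
proof -
  let ?P = "broom_paths t m"
  let ?A = "(\<lambda>a. {HubU, LeafU a}) ` {1..n1}" and ?B = "(\<lambda>q. {HubU, Inner (fst q) (snd q) 2}) ` ?P"
  \<comment> \<open>Since \<open>2 < k i\<close>, the first edge of a path ends in an interior
    vertex, so different paths give different edges at the hub.\<close>
  have first: "path_edge k i j 1 = {HubU, Inner i j 2}" if "(i, j) \<in> ?P" for i j
    using broom_paths_length[OF that k] by (simp add: path_edge_def path_vertex_def numeral_2_eq_2)
  have "{d \<in> edges (broom_graph n1 n2 t m k). HubU \<in> d} = ?A \<union> ?B"
  proof (intro equalityI subsetI)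
    fix d assume "d \<in> {d \<in> edges (broom_graph n1 n2 t m k). HubU \<in> d}"
    then have "d \<in> edges (broom_graph n1 n2 t m k)" "HubU \<in> d" by auto
    then show "d \<in> ?A \<union> ?B"
    proof (cases rule: edge_broom_graph_cases)
      case (path i j l)
      with \<open>HubU \<in> d\<close> have "l = 1" by (auto simp: path_edge_def path_vertex_def split: if_splits)
      with path first[of i j] have "d \<in> ?B" using path(2) by (intro image_eqI[of _ _ "(i, j)"]) simp_all
      then show ?thesis by blast
    qed auto
  next
    fix d assume "d \<in> ?A \<union> ?B"
    then show "d \<in> {d \<in> edges (broom_graph n1 n2 t m k). HubU \<in> d}"
    proof
      assume "d \<in> ?B"
      then obtain i j where "(i, j) \<in> ?P" "d = path_edge k i j 1" "HubU \<in> d" using first by fastforce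
      then show ?thesis
        using broom_graph_edge_intros(3)[of i j t m 1 k] broom_paths_length[OF _ k] by fastforce
    qed (auto simp: broom_graph_edge_intros)
  qed
  moreover have "card (?A \<union> ?B) = card ?A + card ?B"
    using finite_broom_paths by (intro card_Un_disjoint) (auto simp: doubleton_eq_iff)
  moreover have "card ?A = n1"
  proof -
    have "inj_on (\<lambda>a. {HubU, LeafU a}) {1..n1}" by (simp add: inj_on_def doubleton_eq_iff)
    then show ?thesis by (simp add: card_image)
  qed
  moreover have "card ?B = (\<Sum>i=1..t. m i)"
  proof -
    have "inj_on (\<lambda>q. {HubU, Inner (fst q) (snd q) 2}) ?P"
    proof (rule inj_onI)
      fix q r :: "nat \<times> nat"
      assume "{HubU, Inner (fst q) (snd q) 2} = {HubU, Inner (fst r) (snd r) 2}"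
      then have "Inner (fst q) (snd q) 2 \<in> {HubU, Inner (fst r) (snd r) 2}" by blast
      then show "q = r" by (simp add: prod_eq_iff)
    qed
    then show ?thesis by (simp add: card_image card_broom_paths)
  qed
  ultimately show ?thesis by (simp add: degree_def)
qed

lemma degree_HubV:
  assumes k: "\<forall>i\<in>{1..t}. k i > 2"
  shows "degree (broom_graph n1 n2 t m k) HubV = n2 + (\<Sum>i=1..t. m i)"
  using graph_iso_degree[OF simple_broom_graph[OF k] graph_iso_broom_reflect[OF k, of n2 n1], of HubU]
    degree_HubU[OF k, of n2 n1] by (simp add: verts_broom_graph[OF k])

text \<open>A leaf lies on its own edge only, an interior vertex at position \<open>l\<close> only
  on the path edges that start at positions \<open>l - 1\<close> and \<open>l\<close>.\<close>

lemma degree_non_hub: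
  assumes "z \<noteq> HubU" "z \<noteq> HubV"
  shows "degree (broom_graph n1 n2 t m k) z \<le> 2"
proof -
  let ?D = "{d \<in> edges (broom_graph n1 n2 t m k). z \<in> d}"
  have "\<exists>d1 d2. ?D \<subseteq> {d1, d2}"
  proof (cases z)
    case (Inner i j l)
    have "?D \<subseteq> {path_edge k i j (l - 1), path_edge k i j l}"
    proof
      fix d assume "d \<in> ?D"
      then have "d \<in> edges (broom_graph n1 n2 t m k)" "z \<in> d" by auto
      then show "d \<in> {path_edge k i j (l - 1), path_edge k i j l}"
      proof (cases rule: edge_broom_graph_cases)
        case (path i' j' l')
        with \<open>z \<in> d\<close> have "path_vertex k i' j' l' = Inner i j l \<or> path_vertex k i' j' (l' + 1) = Inner i j l"
          by (auto simp: Inner path_edge_def)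
        with path(1) show ?thesis by (auto dest!: path_vertex_eq_Inner)
      qed (use Inner in auto)
    qed
    then show ?thesis by blast
  next
    case (LeafU a)
    have "d = {HubU, z}" if "d \<in> edges (broom_graph n1 n2 t m k)" "z \<in> d" for d
      using that
    proof (cases rule: edge_broom_graph_cases)
      case (path i j l)
      with \<open>z \<in> d\<close> LeafU show ?thesis by (simp add: leaf_notin_path_edge)
    qed (use LeafU in auto)
    then show ?thesis by blast
  next
    case (LeafV b)
    have "d = {HubV, z}" if "d \<in> edges (broom_graph n1 n2 t m k)" "z \<in> d" for d
      using that
    proof (cases rule: edge_broom_graph_cases)
      case (path i j l)
      with \<open>z \<in> d\<close> LeafV show ?thesis by (simp add: leaf_notin_path_edge)
    qed (use LeafV in auto)
    then show ?thesis by blast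
  qed (use assms in auto)
  then obtain d1 d2 where "?D \<subseteq> {d1, d2}" by blast
  then have "card ?D \<le> card {d1, d2}" by (intro card_mono) auto
  also have "\<dots> \<le> 2" by (simp add: card_insert_if)
  finally show ?thesis by (simp add: degree_def)
qed

text \<open>Without one leaf, \<open>HubV\<close> still has degree at least 3, and no other vertex
  except \<open>HubU\<close> can match it. If the leaf returns to \<open>HubU\<close>, equality of
  degrees gives \<open>n2 = n1 + 1\<close>, and the two hubs have just changed roles.\<close>

lemma dern_broom_graph_large_hub:
  assumes k: "\<forall>i\<in>{1..t}. k i > 2" and n: "n1 \<ge> 1" "n2 \<ge> 1"
    and s: "(\<Sum>i=1..t. m i) \<ge> 1" and large: "n2 + (\<Sum>i=1..t. m i) \<ge> 4"
  shows "dern (broom_graph n1 n2 t m k) \<le> 2"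
proof -
  let ?B = "broom_graph n1 n2 t m k" and ?w = "LeafV n2"
  let ?e = "{HubV, LeafV n2}"
  have "broom_paths t m \<noteq> {}" using s card_broom_paths[of t m] by force
  \<comment> \<open>The first edge of some path serves as the second deleted edge.\<close>
  then obtain i0 j0 where ij: "(i0, j0) \<in> broom_paths t m" by auto
  have simple: "simple_graph ?B" using simple_broom_graph[OF k] .
  have e: "?e \<in> edges ?B" using n by (simp add: broom_graph_edge_intros)
  have first: "path_edge k i0 j0 1 = {HubU, Inner i0 j0 2}"
    using broom_paths_length[OF ij k] by (simp add: path_edge_def path_vertex_def numeral_2_eq_2)
  have pendant: "d = ?e" if "d \<in> edges ?B" "?w \<in> d" for d
    using that
  proof (cases rule: edge_broom_graph_cases)
    case (path i j l)
    with \<open>?w \<in> d\<close> show ?thesis by (simp add: leaf_notin_path_edge)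
  qed auto
  show ?thesis
  proof (rule dern_le_2_pendant[OF simple, where e' = "path_edge k i0 j0 1" and v = HubV and w = ?w])
    show "path_edge k i0 j0 1 \<in> edges ?B"
      using broom_graph_edge_intros(3)[OF ij, of 1] broom_paths_length[OF ij k] by simp
    show "?e \<in> edges ?B" by (rule e)
    show "HubV \<noteq> ?w" by simp
    show "d = ?e" if "d \<in> edges ?B" "?w \<in> d" for d by (rule pendant[OF that])
    show "verts ?B \<subseteq> \<Union> (edges ?B - {path_edge k i0 j0 1})"
    proof
      fix z assume z: "z \<in> verts ?B"
      have leafU: "\<exists>d\<in>edges ?B. z \<in> d \<and> d \<noteq> path_edge k i0 j0 1"
        if "1 \<le> a" "a \<le> n1" "z \<in> {HubU, LeafU a}" for a
      proof (rule bexI, intro conjI)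
        show "z \<in> {HubU, LeafU a}" by (rule that(3))
        show "{HubU, LeafU a} \<noteq> path_edge k i0 j0 1"
          using leaf_notin_path_edge(1)[of a k i0 j0 1] by (metis insertCI)
        show "{HubU, LeafU a} \<in> edges ?B" using that by (simp add: broom_graph_edge_intros)
      qed
      have leafV: "\<exists>d\<in>edges ?B. z \<in> d \<and> d \<noteq> path_edge k i0 j0 1"
        if "1 \<le> b" "b \<le> n2" "z \<in> {HubV, LeafV b}" for b
      proof (rule bexI, intro conjI)
        show "z \<in> {HubV, LeafV b}" by (rule that(3))
        show "{HubV, LeafV b} \<noteq> path_edge k i0 j0 1"
          using leaf_notin_path_edge(2)[of b k i0 j0 1] by (metis insertCI)
        show "{HubV, LeafV b} \<in> edges ?B" using that by (simp add: broom_graph_edge_intros)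
      qed
      \<comment> \<open>Leaf edges still cover the hubs and leaves; an interior vertex is covered by
        the path edge that starts at it, which avoids \<open>HubU\<close>.\<close>
      have "\<exists>d\<in>edges ?B. z \<in> d \<and> d \<noteq> path_edge k i0 j0 1"
      proof (cases z)
        case HubU
        then show ?thesis using n by (intro leafU[of 1]) auto
      next
        case HubV
        then show ?thesis using n by (intro leafV[of 1]) auto
      next
        case (LeafU a)
        then show ?thesis using z by (intro leafU[of a]) (auto simp: verts_broom_graph[OF k])
      next
        case (LeafV b)
        then show ?thesis using z by (intro leafV[of b]) (auto simp: verts_broom_graph[OF k])
      next
        case (Inner i j l)
        then have l: "(i, j) \<in> broom_paths t m" "2 \<le> l" "l < k i"
          using z by (auto simp: verts_broom_graph[OF k])
        then have z: "z \<in> path_edge k i j l" and U: "HubU \<notin> path_edge k i j l"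
          by (simp_all add: Inner path_edge_def path_vertex_def)
        have "HubU \<in> path_edge k i0 j0 1" unfolding first by simp
        with U have "path_edge k i j l \<noteq> path_edge k i0 j0 1" by metis
        moreover have "path_edge k i j l \<in> edges ?B" using l by (simp add: broom_graph_edge_intros)
        ultimately show ?thesis using z by blast
      qed
      then show "z \<in> \<Union> (edges ?B - {path_edge k i0 j0 1})" by blast
    qed
    fix y :: broom_vertex and \<psi> :: "broom_vertex \<Rightarrow> broom_vertex"
    let ?G = "delete_edge ?B ?e"
    let ?H = "Graph (verts ?B) (insert {y, ?w} (edges ?B - {?e}))"
    assume y: "y \<in> verts ?B" "y \<noteq> ?w" and deg: "degree ?G y = degree ?G HubV"
    have finite: "finite (edges ?B)" using simple_graph_finite_edges[OF simple] .
    have "{d \<in> edges ?B - {?e}. HubV \<in> d} = {d \<in> edges ?B. HubV \<in> d} - {?e}" by blast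
    then have "degree ?G HubV = degree ?B HubV - 1"
      using e finite by (simp only: degree_def edges_delete_edge) simp
    then have dV: "degree ?G HubV = n2 + (\<Sum>i=1..t. m i) - 1" by (simp only: degree_HubV[OF k])
    have "degree ?G y \<le> degree ?B y"
      unfolding degree_def edges_delete_edge using finite by (intro card_mono) auto
    then have "y = HubU \<or> y = HubV" using degree_non_hub[of y n1 n2 t m k] deg dV large by linarith
    then show "isomorphic ?H ?B"
    proof
      assume "y = HubV"
      then have "?H = ?B" using e by (simp add: insert_absorb)
      then show ?thesis by (simp add: isomorphic_refl)
    next
      assume U: "y = HubU"
      have "{d \<in> edges ?B - {?e}. HubU \<in> d} = {d \<in> edges ?B. HubU \<in> d}" by auto
      then have "degree ?G HubU = degree ?B HubU" by (simp only: degree_def edges_delete_edge)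
      \<comment> \<open>\<open>HubU\<close> has lost no edge, whereas \<open>HubV\<close> has lost
        one; comparing degrees ties the leaf counts.\<close>
      then have n2: "n2 = Suc n1" using deg dV U n degree_HubU[OF k, of n1 n2 m] by simp
      let ?r = "broom_reflect k n2"
      have verts: "?r x \<in> verts ?B \<and> ?r (?r x) = x" if "x \<in> verts ?B" for x
        using that n2 unfolding verts_broom_graph[OF k] by auto
      have rw: "?r ` {HubU, ?w} = ?e" "?r ` ?e = {HubU, ?w}" by auto
      have edges: "?r ` d \<in> edges ?B - {?e}" if "d \<in> edges ?B - {?e}" for d
      proof -
        have "?r ` d \<in> edges ?B"
          using that[THEN DiffD1]
        proof (cases rule: edge_broom_graph_cases)
          case (leafU a)
          with n2 show ?thesis by (simp add: broom_graph_edge_intros)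
        next
          case (leafV b)
          with that n2 have "b \<noteq> n2" by auto
          with leafV n2 show ?thesis by (simp add: broom_graph_edge_intros)
        next
          case (path i j l)
          then show ?thesis by (simp add: broom_reflect_path_edge broom_graph_edge_intros)
        qed
        \<comment> \<open>By involution only \<open>{HubU, LeafV n2}\<close> is sent to the edge
          \<open>?e\<close>, and that pair is not an edge of the broom, as its leaf lies on
          \<open>?e\<close> alone.\<close>
        moreover have "?r ` d \<noteq> ?e"
        proof
          assume r: "?r ` d = ?e"
          have "d \<subseteq> verts ?B" using that simple by (simp add: simple_graph_def)
          then have "?r ` ?r ` d = id ` d" unfolding image_image using verts by (intro image_cong) auto
          then have "d = {HubU, ?w}" using rw r by simp
          then have "?w \<in> d" by simp
          with pendant[OF that[THEN DiffD1]] that[THEN DiffD2] show False by blast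
        qed
        ultimately show ?thesis by blast
      qed
      have H: "edges ?H = insert {HubU, ?w} (edges ?B - {?e})" "verts ?H = verts ?B" using U by auto
      have "graph_iso ?r ?H ?B"
      proof (rule graph_iso_byWitness[where g = ?r])
        fix d assume "d \<in> edges ?H"
        then consider "d = {HubU, ?w}" | "d \<in> edges ?B - {?e}" unfolding H by blast
        then show "?r ` d \<in> edges ?B"
        proof cases
          case 1
          with e rw(1) show ?thesis by simp
        next
          case 2
          from edges[OF this] show ?thesis by simp
        qed
      next
        fix d assume d: "d \<in> edges ?B"
        have "?r ` d \<in> edges ?H"
        proof (cases "d = ?e")
          case True
          then show ?thesis unfolding H using rw(2) by simp
        next
          case False
          with d edges[of d] show ?thesis unfolding H by simp
        qed
        then show "d \<subseteq> verts ?B \<and> ?r ` d \<in> edges ?H"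
          using d simple by (simp add: simple_graph_def)
      qed (use verts in simp_all)
      moreover have "?w \<in> verts ?B" "HubU \<in> verts ?B" using y U n by (auto simp: verts_broom_graph[OF k])
      then have "simple_graph ?H" using simple U by (simp add: simple_graph_def)
      ultimately show ?thesis using isomorphic_iff_graph_iso[OF _ simple] by blast
    qed
  qed
qed

section \<open>The broom with two paths as a cycle with two leaves\<close>

lemma broom_graph_two_paths:
  assumes k: "\<forall>i\<in>{1..t}. k i > 2" and P: "broom_paths t m = {(i1, j1), (i2, j2)}" "(i1, j1) \<noteq> (i2, j2)"
  shows "isomorphic (broom_graph 1 1 t m k) (bipendant_cycle (k i1 + k i2 - 2) (k i1 - 1))"
proof -
  let ?B = "broom_graph 1 1 t m k"
  \<comment> \<open>The hubs are \<open>p\<close> apart along the first path, and both paths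
    together form a cycle of \<open>c\<close> edges.\<close>
  define p where "p = k i1 - 1"
  define c where "c = k i1 + k i2 - 2"
  have k12: "2 < k i1" "2 < k i2" using broom_paths_length[OF _ k] P(1) by blast+
  then have pc: "k i1 = p + 1" "k i2 = c - p + 1" "2 \<le> p" "p + 2 \<le> c" "3 \<le> c" by (auto simp: p_def c_def)
  define f where "f x = (case x of HubU \<Rightarrow> 0 | HubV \<Rightarrow> p | LeafU a \<Rightarrow> c | LeafV b \<Rightarrow> c + 1
    | Inner i j l \<Rightarrow> if (i, j) = (i1, j1) then l - 1 else c + 1 - l)" for x
  (* from HubU along the path (i1, j1) to HubV and back along (i2, j2) *)
  define g where "g x = (if x \<le> p then path_vertex k i1 j1 (x + 1)
    else if x < c then path_vertex k i2 j2 (c + 1 - x) else if x = c then LeafU 1 else LeafV 1)" for x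
  have f1: "f (path_vertex k i1 j1 l) = l - 1" if "1 \<le> l" "l \<le> k i1" for l
    using that pc by (auto simp: f_def path_vertex_def)
  \<comment> \<open>On the way back, position \<open>l\<close> sits at \<open>c + 1 - l\<close>;
    \<open>HubU\<close> closes the cycle at \<open>0\<close> instead of \<open>c\<close>, which is a
    leaf.\<close>
  have f2: "f (path_vertex k i2 j2 l) = (if l = 1 then 0 else c + 1 - l)" if "1 \<le> l" "l \<le> k i2" for l
    using that pc P(2) by (auto simp: f_def path_vertex_def)
  \<comment> \<open>At \<open>x = p\<close> both descriptions give \<open>HubV\<close>, so the
    formula for the second path covers this end too.\<close>
  have g2: "path_vertex k i2 j2 (c + 1 - x) = g x" if "p \<le> x" "x < c" for x
    using that pc by (auto simp: g_def path_vertex_def)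
  have cyc: "{a, b} \<in> edges (bipendant_cycle c p) \<longleftrightarrow>
    a < c \<and> b < c \<and> (b = Suc a \<or> a = Suc b \<or> a = 0 \<and> b = c - 1 \<or> a = c - 1 \<and> b = 0)
    \<or> a = 0 \<and> b = c \<or> a = c \<and> b = 0 \<or> a = p \<and> b = c + 1 \<or> a = c + 1 \<and> b = p" for a b
    using bipendant_cycle_edge_iff[of c p a b] pc by simp
  have "graph_iso f ?B (bipendant_cycle c p)"
  proof (rule graph_iso_byWitness[where g = g])
    fix x assume x: "x \<in> verts ?B"
    show "f x \<in> verts (bipendant_cycle c p) \<and> g (f x) = x"
    proof (cases x)
      case (Inner i j l)
      then have "(i, j) \<in> broom_paths t m" "2 \<le> l" "l < k i"
        using x by (auto simp: verts_broom_graph[OF k])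
      from this(1) have "(i, j) = (i1, j1) \<or> (i, j) = (i2, j2)" unfolding P(1) by blast
      then consider "i = i1" "j = j1" | "i = i2" "j = j2" by blast
      then show ?thesis
      proof cases
        case 1
        then show ?thesis
          using Inner \<open>2 \<le> l\<close> \<open>l < k i\<close> pc by (simp add: f_def g_def bipendant_cycle_def path_vertex_def)
      next
        case 2
        \<comment> \<open>The paths may have the same length class, so only the pair of indices
          tells them apart.\<close>
        then have "\<not> (i = i1 \<and> j = j1)" using P(2) by blast
        then have fx: "f x = c + 1 - l" using Inner by (auto simp: f_def)
        have "p < c + 1 - l" "c + 1 - l < c" "c + 1 - (c + 1 - l) = l"
          using 2 \<open>2 \<le> l\<close> \<open>l < k i\<close> pc by auto
        then have "g (f x) = path_vertex k i2 j2 l" "f x < c" unfolding fx g_def by simp_all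
        then show ?thesis
          using Inner 2 \<open>2 \<le> l\<close> \<open>l < k i\<close> by (simp add: bipendant_cycle_def path_vertex_def)
      qed
    qed (use x pc in \<open>auto simp: f_def g_def bipendant_cycle_def path_vertex_def verts_broom_graph[OF k]\<close>)
  next
    fix x assume "x \<in> verts (bipendant_cycle c p)"
    then consider "x \<le> p" | "p < x" "x < c" | "x = c" | "x = c + 1"
      by (fastforce simp: bipendant_cycle_def)
    then show "g x \<in> verts ?B \<and> f (g x) = x"
    proof cases
      case 1
      then show ?thesis
        using path_vertex_in_verts[of i1 j1 t m "x + 1" k] f1[of "x + 1"] pc P(1) by (simp add: g_def)
    next
      case 2
      then show ?thesis
        using path_vertex_in_verts[of i2 j2 t m "c + 1 - x" k] f2[of "c + 1 - x"] pc P(1) by (simp add: g_def)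
    qed (use pc in \<open>auto simp: g_def f_def verts_broom_graph[OF k]\<close>)
  next
    fix d assume "d \<in> edges ?B"
    then show "f ` d \<in> edges (bipendant_cycle c p)"
    proof (cases rule: edge_broom_graph_cases)
      case (path i j l)
      then consider "i = i1" "j = j1" | "i = i2" "j = j2" using P(1) by auto
      then show ?thesis
      proof cases
        case 1
        then have "f ` d = {l - 1, l}" using path f1[of l] f1[of "l + 1"] by (simp add: path_edge_def)
        moreover have "l - 1 < c" "l < c" "l = Suc (l - 1)" using path pc 1 by auto
        ultimately show ?thesis by (simp add: cyc)
      next
        case 2
        then have "f ` d = {if l = 1 then 0 else c + 1 - l, c - l}"
          using path f2[of l] f2[of "l + 1"] by (simp add: path_edge_def)
        moreover have "1 \<le> l" "l < c" using path pc 2 by auto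
        ultimately show ?thesis by (auto simp: cyc)
      qed
    qed (auto simp: f_def bipendant_cycle_def)
  next
    fix d assume d: "d \<in> edges (bipendant_cycle c p)"
    have "g ` d \<in> edges ?B"
    proof -
      consider "d = {p, c + 1}" | "d = {0, c}" | x where "x < c" "d = {x, Suc x mod c}"
        using d by (auto simp: bipendant_cycle_def cycle_edges_def)
      then show ?thesis
      proof cases
        case 1
        then show ?thesis using pc broom_graph_edge_intros(2)[of 1 1 1 t m k]
          by (simp add: g_def path_vertex_def insert_commute)
      next
        case 2
        then show ?thesis using pc broom_graph_edge_intros(1)[of 1 1 1 t m k]
          by (simp add: g_def path_vertex_def insert_commute)
      next
        case x: 3
        show ?thesis
        proof (cases "x < p")
          case True
          then have "g ` d = path_edge k i1 j1 (x + 1)"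
            using x pc by (simp add: path_edge_def g_def Suc_mod_if)
          then show ?thesis
            using broom_graph_edge_intros(3)[of i1 j1 t m "x + 1" k] True pc P(1) by simp
        next
          case False
          \<comment> \<open>The last cycle edge wraps from \<open>c - 1\<close> to \<open>0\<close>,
            which is position \<open>1\<close> of the second path.\<close>
          have "g (Suc x mod c) = path_vertex k i2 j2 (c - x)"
          proof (cases "Suc x = c")
            case True
            then have "c - x = 1" by simp
            with True show ?thesis using pc by (simp add: g_def path_vertex_def)
          next
            case False
            then show ?thesis using g2[of "Suc x"] x \<open>\<not> x < p\<close> by (simp add: Suc_mod_if)
          qed
          moreover have "c - x + 1 = c + 1 - x" using x by simp
          ultimately have "g ` d = path_edge k i2 j2 (c - x)"
            using x False g2[of x] by (simp add: path_edge_def insert_commute)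
          then show ?thesis
            using broom_graph_edge_intros(3)[of i2 j2 t m "c - x" k] False x pc P(1) by simp
        qed
      qed
    qed
    moreover have "d \<subseteq> verts (bipendant_cycle c p)"
      using d simple_bipendant_cycle[of c p] pc by (auto simp: simple_graph_def)
    ultimately show "d \<subseteq> verts (bipendant_cycle c p) \<and> g ` d \<in> edges ?B" by blast
  qed
  then show ?thesis
    using isomorphic_iff_graph_iso[OF simple_broom_graph[OF k] simple_bipendant_cycle[of c p]] pc
    unfolding p_def c_def by auto
qed

lemma dern_broom_graph_two_paths:
  assumes k: "\<forall>i\<in>{1..t}. k i > 2" and s: "(\<Sum>i=1..t. m i) = 2"
  shows "dern (broom_graph 1 1 t m k) \<le> 2"
proof -
  obtain a b where ab: "broom_paths t m = {a, b}" "a \<noteq> b"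
    using s card_broom_paths[of t m] by (metis card_2_iff)
  \<comment> \<open>Naming a shorter path first gives \<open>2 * p \<le> c\<close> for
    \<open>p = k i1 - 1\<close> and \<open>c = k i1 + k i2 - 2\<close>.\<close>
  obtain i1 j1 i2 j2 where P: "broom_paths t m = {(i1, j1), (i2, j2)}" "(i1, j1) \<noteq> (i2, j2)" "k i1 \<le> k i2"
  proof (cases "k (fst a) \<le> k (fst b)")
    case True
    then show ?thesis using that[of "fst a" "snd a" "fst b" "snd b"] ab by simp
  next
    case False
    then show ?thesis using that[of "fst b" "snd b" "fst a" "snd a"] ab by (simp add: insert_commute)
  qed
  have k12: "2 < k i1" "2 < k i2" using broom_paths_length[OF _ k] P(1) by blast+
  then have "simple_graph (bipendant_cycle (k i1 + k i2 - 2) (k i1 - 1))"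
    by (intro simple_bipendant_cycle) auto
  from dern_cong[OF simple_broom_graph[OF k] this broom_graph_two_paths[OF k P(1,2)]]
  show ?thesis using dern_bipendant_cycle[of "k i1 - 1" "k i1 + k i2 - 2"] k12 P(3) by simp
qed

theorem theorem2p5:
  fixes G :: "'a graph" and n1 n2 t :: nat and m k :: "nat \<Rightarrow> nat"
  assumes "is_strong_double_broom G n1 n2 t m k"
    and "\<forall>i\<in>{1..t}. k i > 2"
  shows "dern G = 1 \<or> dern G = 2"
proof -
  have G: "simple_graph G" "5 \<le> card (verts G)" "1 \<le> n1" "1 \<le> n2" "2 \<le> (\<Sum>i=1..t. m i)"
      "isomorphic G (broom_graph n1 n2 t m k)"
    using assms(1) unfolding is_strong_double_broom_def by auto
  note simple = simple_broom_graph[OF assms(2)]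
  have "dern (broom_graph n1 n2 t m k) \<le> 2"
  proof -
    \<comment> \<open>If neither hub has degree at least 4, the lower bounds of one leaf per hub and
      two paths are all attained.\<close>
    consider "4 \<le> n2 + (\<Sum>i=1..t. m i)" | "4 \<le> n1 + (\<Sum>i=1..t. m i)"
      | "n1 = 1" "n2 = 1" "(\<Sum>i=1..t. m i) = 2"
      using G(3-5) by linarith
    then show ?thesis
    proof cases
      case 1
      then show ?thesis using dern_broom_graph_large_hub[OF assms(2)] G by simp
    next
      case 2
      \<comment> \<open>Exchanging the hubs by reflection puts the hub of large degree in the role
        of \<open>HubV\<close>.\<close>
      have "isomorphic (broom_graph n1 n2 t m k) (broom_graph n2 n1 t m k)"
        using graph_iso_broom_reflect[OF assms(2)] isomorphic_iff_graph_iso[OF simple simple] by blast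
      then have "dern (broom_graph n1 n2 t m k) = dern (broom_graph n2 n1 t m k)"
        by (rule dern_cong[OF simple simple])
      then show ?thesis using dern_broom_graph_large_hub[OF assms(2), of n2 n1 m] G 2 by simp
    next
      case 3
      then show ?thesis using dern_broom_graph_two_paths[OF assms(2)] by simp
    qed
  qed
  then have "dern G \<le> 2" using dern_cong[OF G(1) simple G(6)] by simp
  moreover have "1 \<le> dern G" using dern_ge_1[of G] G(2) by fastforce
  ultimately show ?thesis
    by (cases "dern G") (auto simp: one_enat_def numeral_eq_enat)
qed

end
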